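(* Let $f:\mathbb{R}^d\to\mathbb{R}$ be a continuously differentiable, convex and coercive function that is both Hölder smooth and block Hölder smooth with exponent $\gamma\in(0,1]$ and block constants $L_1,\dots,L_m>0$. Let $\nu=\frac{1+\gamma}{\gamma}$, $f^*:=\min_{x\in\mathbb{R}^d} f(x)$, $\alpha\in[0,1]$, and let $\{x^k\}_{k\ge0}$ be the sequence generated by the Randomized Block Coordinate Descent method (RBCD) with parameter $\alpha$ from $x^0\in\mathbb{R}^d$. Put \[ R:=\max\left\{\|y-x^*\|_{(1+\alpha-\nu)(1-\nu),\,\frac{\nu}{\nu-1}}:\ x^*,y\in\mathbb{R}^d,\ f(x^* )=f^*,\ f(y)\le f(x^0)\right\}<\infty . \] Then for all $k\ge 0$, \[ \mathbb{E}[f(x^{k})]- f^*\leq\frac{\left(\nu S_\alpha R^\nu\right)^{\frac{1}{\nu-1}}(\nu-1)}{\left[2\nu^{\nu-1}+(\nu-1)^\nu k\right]^{\frac{1}{\nu-1}}}=O\left(k^{-\frac{1}{\nu-1}}\right), \] where the $O(\cdot)$ is as $k\to\infty$.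
   Context: Setting. $\|\cdot\|$ is the Euclidean norm on $\mathbb{R}^d$. $P_1,\dots,P_m\in\mathbb{R}^{d\times d}$ are orthogonal projection matrices onto mutually orthogonal subspaces whose sum is $\mathbb{R}^d$ (so $\sum_i P_i=I$), and $\nabla_i f(x):=P_i\nabla f(x)$. Coercive means $f(x)\to\infty$ as $\|x\|\to\infty$. Hölder smoothness with exponent $\gamma\in(0,1]$: there is $L>0$ with $\|\nabla f(y)-\nabla f(x)\|\le L\|y-x\|^\gamma$ for all $x,y\in\mathbb{R}^d$. Block Hölder smoothness with exponent $\gamma$ and constants $L_1,\dots,L_m>0$: for each $i=1,\dots,m$, $\|\nabla f(x+P_iu)-\nabla f(x)\|\le L_i\|P_iu\|^\gamma$ for all $x,u\in\mathbb{R}^d$. Notation. $\nu:=\frac{1+\gamma}{\gamma}\ge 2$. For $\alpha\in\mathbb{R}$, $S_\alpha:=\sum_{i=1}^m L_i^\alpha$. For $\beta\in\mathbb{R}$ and $q\ge1$, $\|x\|_{\beta,q}:=\left[\sum_{i=1}^m L_i^\beta\|P_ix\|^q\right]^{1/q}$. RBCD with parameter $\alpha\in[0,1]$: given a (deterministic) $x^0\in\mathbb{R}^d$, for $k=0,1,2,\dots$ draw $i_k\in\{1,\dots,m\}$ at random, independently of the past, with $\Pr(i_k=i)=L_i^\alpha/\sum_{j=1}^m L_j^\alpha$, and set \[ x^{k+1}:=x^k-\frac{\|\nabla_{i_k}f(x^k)\|^{\nu-2}}{L_{i_k}^{\nu-1}}\nabla_{i_k}f(x^k) \] (the step is $0$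 if $\nabla_{i_k}f(x^k)=0$).
   Formalization: The weight exponent in R is (1+α−ν)/(1−ν) instead of (1+α−ν)(1−ν); they agree for γ=1, and for γ<1 the printed exponent makes the bound false, e.g. f(x)=|x|^{3/2}/10 on the line, one block, γ=1/2, L=3√2/20, α=0, x^0=1, k=0. *)

theory Defs
  imports
    "HOL-Analysis.Analysis"
    "HOL-Probability.Probability"
    "HOL-Library.Landau_Symbols"
begin

definition orth_projection_onto :: "real^'n^'n \<Rightarrow> (real^'n) set \<Rightarrow> bool" where
  "orth_projection_onto A V \<longleftrightarrow>
     subspace V \<and> (\<forall>x. A *v x \<in> V \<and> (\<forall>v\<in>V. orthogonal (x - A *v x) v))"

definition block_projections :: "('m::finite \<Rightarrow> real^'n^'n) \<Rightarrow> bool" where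
  "block_projections P \<longleftrightarrow>
     (\<exists>V. (\<forall>i. orth_projection_onto (P i) (V i)) \<and>
          (\<forall>i j. i \<noteq> j \<longrightarrow> (\<forall>u\<in>V i. \<forall>v\<in>V j. orthogonal u v)) \<and>
          span (\<Union>i. V i) = UNIV)"

(* In the three definitions below and in the theorem, g stands for the gradient of f. *)

definition holder_smooth :: "real \<Rightarrow> (real^'n \<Rightarrow> real^'n) \<Rightarrow> bool" where
  "holder_smooth \<gamma> g \<longleftrightarrow>
     (\<exists>K>0. \<forall>x y. norm (g y - g x) \<le> K * norm (y - x) powr \<gamma>)"

definition block_holder_smooth ::
  "real \<Rightarrow> ('m::finite \<Rightarrow> real) \<Rightarrow> ('m \<Rightarrow> real^'n^'n) \<Rightarrow> (real^'n \<Rightarrow> real^'n) \<Rightarrow> bool" where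
  "block_holder_smooth \<gamma> L P g \<longleftrightarrow>
     (\<forall>i x u. norm (g (x + P i *v u) - g x) \<le> L i * norm (P i *v u) powr \<gamma>)"

definition pow_sum :: "('m::finite \<Rightarrow> real) \<Rightarrow> real \<Rightarrow> real" where
  "pow_sum L \<alpha> = (\<Sum>i\<in>UNIV. L i powr \<alpha>)"

definition block_norm ::
  "('m::finite \<Rightarrow> real) \<Rightarrow> ('m \<Rightarrow> real^'n^'n) \<Rightarrow> real \<Rightarrow> real \<Rightarrow> real^'n \<Rightarrow> real" where
  "block_norm L P \<beta> q x = (\<Sum>i\<in>UNIV. L i powr \<beta> * norm (P i *v x) powr q) powr (1 / q)"

(* The iterates as a function of the sequence c of drawn blocks. For \<nu> = 2 and a vanishing
   block gradient the factor 0 powr 0 is 0 in HOL (not 1), but it multiplies the zero vector,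
   so the step is 0 as required. *)
primrec rbcd ::
  "real \<Rightarrow> ('m::finite \<Rightarrow> real) \<Rightarrow> ('m \<Rightarrow> real^'n^'n) \<Rightarrow> (real^'n \<Rightarrow> real^'n) \<Rightarrow> real^'n
     \<Rightarrow> (nat \<Rightarrow> 'm) \<Rightarrow> nat \<Rightarrow> real^'n" where
  "rbcd \<nu> L P g x0 c 0 = x0"
| "rbcd \<nu> L P g x0 c (Suc k) =
     (let x = rbcd \<nu> L P g x0 c k; i = c k; d = P i *v g x
      in x - (norm d powr (\<nu> - 2) / L i powr (\<nu> - 1)) *\<^sub>R d)"

(* The distances whose maximum is R.

   Deviation from the printed source, which has the weight exponent
   (1 + \<alpha> - \<nu>) * (1 - \<nu>) in place of (1 + \<alpha> - \<nu>) / (1 - \<nu>). The two agree for \<nu> = 2, i.e. for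
   \<gamma> = 1. For \<nu> > 2 the printed exponent makes the theorem false (f x = \<bar>x\<bar> powr (3/2) / 10 on
   the line, one block, \<gamma> = 1/2, L = 3 * sqrt 2 / 20, \<alpha> = 0, x0 = 1, k = 0). The quotient is
   the exponent of the norm dual to block_norm L P (1 + \<alpha> - \<nu>) \<nu>. *)
definition level_distances ::
  "(real^'n \<Rightarrow> real) \<Rightarrow> ('m::finite \<Rightarrow> real) \<Rightarrow> ('m \<Rightarrow> real^'n^'n) \<Rightarrow> real \<Rightarrow> real \<Rightarrow> real
     \<Rightarrow> real^'n \<Rightarrow> real set" where
  "level_distances f L P \<alpha> \<nu> fstar x0 =
     {block_norm L P ((1 + \<alpha> - \<nu>) / (1 - \<nu>)) (\<nu> / (\<nu> - 1)) (y - xs) | xs y.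
        f xs = fstar \<and> f y \<le> f x0}"

end

theory Submission
  imports Defs
begin

text \<open>
  A step on block $i$ decreases $f$ by at least $\|\nabla_i f\|^\nu / (\nu L_i^{\nu-1})$. Averaging over $i$,
  the expected decrease is $\|\nabla f\|_{1+\alpha-\nu,\nu}^\nu / (\nu S_\alpha)$, and convexity with
  Hoelder's inequality bounds $f(x) - f^*$ by $R$ times this gradient norm. By Jensen's inequality the
  expected gaps $a_k$ satisfy $a_{k+1} \le a_k - a_k^\nu / C$ with $C = \nu S_\alpha R^\nu$, so
  $a_k^{1-\nu}$ grows by at least $(\nu-1)/C$ per step. The constant $2 \nu^{\nu-1}$ comes from the initial gap,
  for which $(\frac{\nu}{\nu-1} a_0)^{\nu-1} \le S_\alpha R^\nu$; here $\nu \ge 2$ enters.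
\<close>

section \<open>Tangents, Hoelder's inequality and descent\<close>

text \<open>With u = t / s this is 1 + p (u - 1) \<le> \<open>u powr p\<close>, which combines ln u
  \<le> u - 1, reversed by the factor p \<le> 0, with 1 + z \<le> exp z. It later drives the growth
  of the negative powers of the gaps.\<close>

lemma powr_tangent_nonpos:
  fixes p s t :: real
  assumes "p \<le> 0" "s > 0" "t > 0"
  shows "s powr p + p * s powr (p - 1) * (t - s) \<le> t powr p"
proof -
  have "p * (t / s - 1) \<le> p * ln (t / s)"
    using assms ln_le_minus_one[of "t / s"] by (intro mult_left_mono_neg) auto
  also have "1 + p * ln (t / s) \<le> (t / s) powr p"
    using assms exp_ge_add_one_self[of "p * ln (t / s)"] by (simp add: powr_def)
  finally have "s powr p * (1 + p * (t / s - 1)) \<le> s powr p * (t / s) powr p"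
    by (intro mult_left_mono) auto
  moreover have "s powr p * (t / s) powr p = t powr p"
    using assms by (simp flip: powr_mult)
  moreover have "s powr p * (1 + p * (t / s - 1)) = s powr p + p * s powr (p - 1) * (t - s)"
    using assms by (simp add: powr_diff field_simps)
  ultimately show ?thesis by simp
qed

text \<open>Young's inequality for t and \<open>s powr (p - 1)\<close> with exponents p and p / (p -
  1), rearranged. The base point s = 0 is allowed because an expected gap may vanish.\<close>

lemma powr_tangent_ge_one:
  fixes p s t :: real
  assumes "p > 1" "s \<ge> 0" "t \<ge> 0"
  shows "s powr p + p * s powr (p - 1) * (t - s) \<le> t powr p"
proof -
  have "t * s powr (p - 1) \<le> t powr p / p + (s powr (p - 1)) powr (p / (p - 1)) / (p / (p - 1))"
    using assms by (intro Youngs_inequality) (auto simp: field_simps)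
  also have "(s powr (p - 1)) powr (p / (p - 1)) = s powr p"
    using assms by (simp add: powr_powr)
  finally have "p * (t * s powr (p - 1)) \<le> t powr p + (p - 1) * s powr p"
    using assms by (simp add: field_simps)
  moreover have "s powr p = s powr (p - 1) * s"
    using assms by (cases "s = 0") (auto simp: powr_diff)
  ultimately show ?thesis
    by (simp add: algebra_simps)
qed

text \<open>Dividing both families by their norms A and B and applying Young's inequality to each
  term bounds the normalized sum by 1 / p + 1 / q = 1. If one of the norms is zero, all products
  vanish.\<close>

lemma Holder_sum:
  fixes a b :: "'a \<Rightarrow> real" and p q :: real
  assumes pq: "p > 1" "q > 1" "1 / p + 1 / q = 1" and "finite I"
    and a: "\<And>i. i \<in> I \<Longrightarrow> a i \<ge> 0" and b: "\<And>i. i \<in> I \<Longrightarrow> b i \<ge> 0"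
  shows "(\<Sum>i\<in>I. a i * b i) \<le> (\<Sum>i\<in>I. a i powr p) powr (1 / p) * (\<Sum>i\<in>I. b i powr q) powr (1 / q)"
proof (cases "(\<Sum>i\<in>I. a i powr p) = 0 \<or> (\<Sum>i\<in>I. b i powr q) = 0")
  case True
  then have "a i * b i = 0" if "i \<in> I" for i
    using that \<open>finite I\<close> by (auto simp: sum_nonneg_eq_0_iff)
  then show ?thesis by (simp add: sum.neutral)
next
  case False
  define A where "A = (\<Sum>i\<in>I. a i powr p) powr (1 / p)"
  define B where "B = (\<Sum>i\<in>I. b i powr q) powr (1 / q)"
  have pos: "(\<Sum>i\<in>I. a i powr p) > 0" "(\<Sum>i\<in>I. b i powr q) > 0"
    using False by (auto simp: less_le intro!: sum_nonneg)
  then have AB: "A > 0" "B > 0" by (auto simp: A_def B_def)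
  have "(\<Sum>i\<in>I. a i / A * (b i / B)) \<le> (\<Sum>i\<in>I. (a i / A) powr p / p + (b i / B) powr q / q)"
    using a b AB pq by (intro sum_mono Youngs_inequality) auto
  also have "\<dots> = (\<Sum>i\<in>I. a i powr p) / A powr p / p + (\<Sum>i\<in>I. b i powr q) / B powr q / q"
    using a b AB by (simp add: sum.distrib powr_divide sum_divide_distrib)
  also have "\<dots> = 1"
    using pos pq by (simp add: A_def B_def powr_powr)
  finally have "(\<Sum>i\<in>I. a i * b i) / (A * B) \<le> 1"
    by (simp add: sum_divide_distrib)
  then show ?thesis
    using AB by (simp add: A_def B_def)
qed

text \<open>By convexity the difference quotient of f from x towards y is at most f y - f x for
  every 0 < t < 1; letting t tend to 0 from the right turns the quotient into the directional
  derivative.\<close>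

lemma convex_on_GDERIV_ge:
  fixes f :: "'a::real_inner \<Rightarrow> real"
  assumes "convex_on UNIV f" "GDERIV f x :> g"
  shows "f x + inner g (y - x) \<le> f y"
proof -
  define \<phi> where "\<phi> t = f (x + t *\<^sub>R (y - x))" for t :: real
  have "(f has_derivative (\<lambda>h. h \<bullet> g)) (at (x + 0 *\<^sub>R (y - x)))"
    using assms(2) by (simp add: gderiv_def)
  then have "(\<phi> has_derivative (\<lambda>t. (t *\<^sub>R (y - x)) \<bullet> g)) (at 0)"
    unfolding \<phi>_def by (rule has_derivative_compose[rotated]) (auto intro!: derivative_eq_intros)
  then have "(\<phi> has_real_derivative inner g (y - x)) (at 0)"
    unfolding has_field_derivative_def
    by (rule has_derivative_eq_rhs) (auto simp: inner_commute)
  then have "((\<lambda>t. (\<phi> t - \<phi> 0) / t) \<longlongrightarrow> inner g (y - x)) (at_right 0)"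
    by (auto simp: has_field_derivative_iff intro: filterlim_mono at_le)
  moreover have "\<forall>\<^sub>F t in at_right 0. (\<phi> t - \<phi> 0) / t \<le> f y - f x"
    unfolding eventually_at_right_field
  proof (intro exI[of _ 1] conjI allI impI)
    fix t :: real assume t: "0 < t" "t < 1"
    have "\<phi> t \<le> (1 - t) * f x + t * f y"
      using convex_onD[OF assms(1), of t x y] t
      by (simp add: \<phi>_def algebra_simps)
    then show "(\<phi> t - \<phi> 0) / t \<le> f y - f x"
      using t by (simp add: \<phi>_def field_simps)
  qed simp
  ultimately have "inner g (y - x) \<le> f y - f x"
    by (rule tendsto_upperbound) simp
  then show ?thesis by simp
qed

text \<open>Along the segment, \<phi> subtracts from f the linear part and the integrated Hoelder
  bound. Cauchy-Schwarz makes its derivative nonpositive on (0, 1), so \<phi> 1 \<le> \<phi> 0. The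
  assumption concerns only the direction h, so that block smoothness can supply it.\<close>

lemma holder_descent:
  fixes f :: "'a::real_inner \<Rightarrow> real" and g :: "'a \<Rightarrow> 'a"
  assumes f: "\<And>x. GDERIV f x :> g x" and "\<gamma> > 0"
    and g: "\<And>t. 0 < t \<Longrightarrow> t < 1 \<Longrightarrow> norm (g (x + t *\<^sub>R h) - g x) \<le> K * norm (t *\<^sub>R h) powr \<gamma>"
  shows "f (x + h) \<le> f x + inner (g x) h + K / (1 + \<gamma>) * norm h powr (1 + \<gamma>)"
proof -
  define \<phi> where "\<phi> t = f (x + t *\<^sub>R h) - t * inner (g x) h
    - K / (1 + \<gamma>) * norm h powr (1 + \<gamma>) * t powr (1 + \<gamma>)" for t :: real
  have f': "((\<lambda>t. f (x + t *\<^sub>R h)) has_real_derivative inner (g (x + t *\<^sub>R h)) h) (at t)" for t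
  proof -
    have "(f has_derivative (\<lambda>v. v \<bullet> g (x + t *\<^sub>R h))) (at (x + t *\<^sub>R h))"
      using f[of "x + t *\<^sub>R h"] by (simp add: gderiv_def)
    then have "((\<lambda>t. f (x + t *\<^sub>R h)) has_derivative (\<lambda>s. (s *\<^sub>R h) \<bullet> g (x + t *\<^sub>R h))) (at t)"
      by (rule has_derivative_compose[rotated]) (auto intro!: derivative_eq_intros)
    then show ?thesis
      unfolding has_field_derivative_def
      by (rule has_derivative_eq_rhs) (auto simp: inner_commute)
  qed
  have "\<phi> 1 \<le> \<phi> 0"
  proof (rule DERIV_nonpos_imp_decreasing_open[where f = \<phi> and a = 0 and b = 1])
    fix t :: real assume t: "0 < t" "t < 1"
    have "inner (g (x + t *\<^sub>R h) - g x) h \<le> norm (g (x + t *\<^sub>R h) - g x) * norm h"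
      by (rule norm_cauchy_schwarz)
    also have "\<dots> \<le> K * norm (t *\<^sub>R h) powr \<gamma> * norm h"
      using g t by (intro mult_right_mono) auto
    also have "\<dots> = K * norm h powr (1 + \<gamma>) * t powr \<gamma>"
      using t by (cases "h = 0") (auto simp: powr_mult powr_add)
    finally have le: "inner (g (x + t *\<^sub>R h)) h - inner (g x) h - K * norm h powr (1 + \<gamma>) * t powr \<gamma> \<le> 0"
      by (simp add: inner_diff_left)
    have D: "DERIV \<phi> t :> inner (g (x + t *\<^sub>R h)) h - inner (g x) h
        - K / (1 + \<gamma>) * norm h powr (1 + \<gamma>) * ((1 + \<gamma>) * t powr \<gamma>)"
      unfolding \<phi>_def using t by (auto intro!: derivative_eq_intros f')
    have eq: "K / (1 + \<gamma>) * norm h powr (1 + \<gamma>) * ((1 + \<gamma>) * t powr \<gamma>) = K * norm h powr (1 + \<gamma>) * t powr \<gamma>"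
      using \<open>\<gamma> > 0\<close> by simp
    from D have "DERIV \<phi> t :> inner (g (x + t *\<^sub>R h)) h - inner (g x) h - K * norm h powr (1 + \<gamma>) * t powr \<gamma>"
      unfolding eq .
    with le show "\<exists>y. DERIV \<phi> t :> y \<and> y \<le> 0" by blast
  next
    have "continuous_on {0..1} (\<lambda>t. f (x + t *\<^sub>R h))"
      by (rule DERIV_continuous_on, rule has_field_derivative_at_within, rule f')
    then show "continuous_on {0..1} \<phi>"
      unfolding \<phi>_def using \<open>\<gamma> > 0\<close> by (intro continuous_intros continuous_on_powr') auto
  qed simp
  then show ?thesis by (simp add: \<phi>_def)
qed

text \<open>Convexity of \<open>t powr (1 - \<nu>)\<close> turns the recursion into linear growth: b
  (j + 1) - b j \<ge> (\<nu> - 1) / C. The initial condition says b 0 \<ge> D / C, written as a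
  product so that it also makes sense for a 0 = 0.\<close>

lemma powr_recursion_bound:
  fixes a :: "nat \<Rightarrow> real" and C D \<nu> :: real
  assumes "\<nu> > 1" "C > 0" "D > 0"
    and nonneg: "\<And>k. a k \<ge> 0"
    and step: "\<And>k. a (Suc k) \<le> a k - a k powr \<nu> / C"
    and init: "D * a 0 powr (\<nu> - 1) \<le> C"
  shows "a k \<le> (C / (D + (\<nu> - 1) * real k)) powr (1 / (\<nu> - 1))"
proof (cases "a k = 0")
  case False
  define b where "b k = a k powr (1 - \<nu>)" for k
  \<comment> \<open>The sequence decreases, so a nonzero gap at k forces all earlier gaps to be
    positive; only then do the negative powers b j carry information.\<close>
  have dec: "a (Suc k) \<le> a k" for k
    using step[of k] \<open>C > 0\<close> by (smt (verit) divide_nonneg_pos powr_ge_zero)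
  then have pos: "a j > 0" if "j \<le> k" for j
    using False nonneg[of k] lift_Suc_antimono_le[of a j k] that by fastforce
  have "D / C + (\<nu> - 1) / C * real j \<le> b j" if "j \<le> k" for j
    using that
  proof (induction j)
    case 0
    have "D \<le> C * a 0 powr (1 - \<nu>)"
      using init pos[of 0] by (simp add: powr_diff field_simps)
    then show ?case
      using \<open>C > 0\<close> by (simp add: b_def field_simps)
  next
    case (Suc j)
    then have aj: "a j > 0" "a (Suc j) > 0" using pos by auto
    have "(\<nu> - 1) / C = (\<nu> - 1) * a j powr (- \<nu>) * (a j powr \<nu> / C)"
      using aj by (simp add: powr_minus)
    also have "\<dots> \<le> (\<nu> - 1) * a j powr (- \<nu>) * (a j - a (Suc j))"
      using step[of j] \<open>\<nu> > 1\<close> by (intro mult_left_mono) auto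
    also have "\<dots> \<le> b (Suc j) - b j"
      using powr_tangent_nonpos[of "1 - \<nu>" "a j" "a (Suc j)"] aj \<open>\<nu> > 1\<close>
      by (simp add: b_def algebra_simps)
    finally show ?case
      using Suc by (simp add: algebra_simps add_divide_distrib diff_divide_distrib)
  qed
  from this[of k] have "(D + (\<nu> - 1) * real k) / C \<le> 1 / a k powr (\<nu> - 1)"
    using powr_minus_divide[of "a k" "\<nu> - 1"] by (simp add: b_def add_divide_distrib)
  moreover have "D + (\<nu> - 1) * real k > 0"
    using assms(1-3) by (intro add_pos_nonneg) auto
  ultimately have "a k powr (\<nu> - 1) \<le> C / (D + (\<nu> - 1) * real k)"
    using pos[of k] \<open>C > 0\<close> by (simp add: divide_le_eq le_divide_eq mult.commute)
  then have "(a k powr (\<nu> - 1)) powr (1 / (\<nu> - 1)) \<le> (C / (D + (\<nu> - 1) * real k)) powr (1 / (\<nu> - 1))"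
    using \<open>\<nu> > 1\<close> by (intro powr_mono2) auto
  then show ?thesis
    using pos[of k] \<open>\<nu> > 1\<close> by (simp add: powr_powr)
qed simp

section \<open>Block projections\<close>

context
  fixes P :: "'m::finite \<Rightarrow> real^'n^'n"
  assumes P: "block_projections P"
begin

text \<open>For idempotence, P x - P (P x) lies in V i and is orthogonal to V i, hence to itself.
  For the sum, the residual z is orthogonal to each V j, since only the j-th summand survives there,
  hence to their span and so to itself. For self-adjointness, both sides equal the inner product of
  the two projections.\<close>

lemma block_projections_idem: "P i *v (P i *v x) = P i *v x"
  and block_projections_orthogonal: "i \<noteq> j \<Longrightarrow> inner (P i *v x) (P j *v y) = 0"
  and block_projections_sum: "(\<Sum>i\<in>UNIV. P i *v x) = x"
  and block_projections_selfadjoint: "inner (P i *v x) y = inner x (P i *v y)"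
proof -
  obtain V where V: "\<And>i. subspace (V i)" "\<And>i x. P i *v x \<in> V i"
      "\<And>i x v. v \<in> V i \<Longrightarrow> inner (x - P i *v x) v = 0"
    and orth: "\<And>i j u v. i \<noteq> j \<Longrightarrow> u \<in> V i \<Longrightarrow> v \<in> V j \<Longrightarrow> inner u v = 0"
    and span: "span (\<Union>i. V i) = UNIV"
    using P unfolding block_projections_def orth_projection_onto_def orthogonal_def by metis
  show "P i *v (P i *v x) = P i *v x"
    using V(3)[of "P i *v x - P i *v (P i *v x)" i "P i *v x"] V(1,2)
    by (simp add: subspace_diff)
  show "inner (P i *v x) (P j *v y) = 0" if "i \<noteq> j"
    using orth[OF that V(2) V(2)] .
  have eq: "inner (P i *v x) (P i *v y) = inner x (P i *v y)" for x y
    using V(3)[OF V(2)[of i y], of x] by (simp add: inner_diff_left)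
  then show "inner (P i *v x) y = inner x (P i *v y)"
    by (metis inner_commute)
  define z where "z = x - (\<Sum>i\<in>UNIV. P i *v x)"
  have "inner z v = 0" if "v \<in> V j" for v j
  proof -
    have "(\<Sum>i\<in>UNIV. inner (P i *v x) v) = (\<Sum>i\<in>UNIV. if i = j then inner (P j *v x) v else 0)"
      using orth[OF _ V(2) that] by (intro sum.cong) auto
    then show ?thesis
      using V(3)[OF that, of x] by (simp add: z_def inner_diff_left inner_sum_left)
  qed
  then have "orthogonal z v" if "v \<in> (\<Union>i. V i)" for v
    using that by (auto simp: orthogonal_def)
  then have "orthogonal z z"
    using orthogonal_to_span[of z "\<Union>i. V i" z] span by blast
  then show "(\<Sum>i\<in>UNIV. P i *v x) = x"
    by (simp add: z_def orthogonal_self)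
qed

lemma inner_block_projections: "inner x y = (\<Sum>i\<in>UNIV. inner (P i *v x) (P i *v y))"
proof -
  have "inner x y = inner x (\<Sum>i\<in>UNIV. P i *v y)"
    by (simp add: block_projections_sum)
  also have "\<dots> = (\<Sum>i\<in>UNIV. inner (P i *v x) (P i *v y))"
    by (simp add: inner_sum_right block_projections_selfadjoint block_projections_idem)
  finally show ?thesis .
qed

end

section \<open>Independent draws\<close>

text \<open>The invariance under \<open>restrict\<close> expresses that h depends only on the first
  k draws. These take finitely many values, so h of them is bounded and, on a discrete space,
  measurable.\<close>

lemma (in prob_space) integrable_finitely_many_draws:
  fixes X :: "nat \<Rightarrow> 'a \<Rightarrow> 'm::finite" and h :: "(nat \<Rightarrow> 'm) \<Rightarrow> real"
  assumes "\<And>j. X j \<in> measurable M (count_space UNIV)"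
    and h: "\<And>c. h (restrict c {..<k}) = h c"
  shows "integrable M (\<lambda>\<omega>. h (\<lambda>j. X j \<omega>))"
proof -
  let ?D = "PiE {..<k} (\<lambda>_. UNIV) :: (nat \<Rightarrow> 'm) set"
  have m: "(\<lambda>\<omega>. restrict (\<lambda>j. X j \<omega>) {..<k}) \<in> measurable M (count_space ?D)"
    using measurable_restrict[of "{..<k}" X M "\<lambda>_. count_space UNIV"] assms(1)
    by (simp add: count_space_PiM_finite)
  have fin: "finite ?D" by (intro finite_PiE) auto
  have "integrable M (\<lambda>\<omega>. h (restrict (\<lambda>j. X j \<omega>) {..<k}))"
  proof (rule integrable_const_bound[of _ "\<Sum>c\<in>?D. \<bar>h c\<bar>"])
    show "AE \<omega> in M. norm (h (restrict (\<lambda>j. X j \<omega>) {..<k})) \<le> (\<Sum>c\<in>?D. \<bar>h c\<bar>)"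
    proof (intro AE_I2)
      fix \<omega>
      have "restrict (\<lambda>j. X j \<omega>) {..<k} \<in> ?D" by simp
      from member_le_sum[OF this _ fin, of "\<lambda>c. \<bar>h c\<bar>"]
      show "norm (h (restrict (\<lambda>j. X j \<omega>) {..<k})) \<le> (\<Sum>c\<in>?D. \<bar>h c\<bar>)"
        by simp
    qed
    show "(\<lambda>\<omega>. h (restrict (\<lambda>j. X j \<omega>) {..<k})) \<in> borel_measurable M"
      by (rule measurable_compose[OF m]) simp
  qed
  then show ?thesis by (simp add: h)
qed

text \<open>This plays the role of conditioning on the past: the integrand is split by indicators of
  the value of draw k, and each indicator is independent of the draws before k, so every term
  factorizes.\<close>

lemma (in prob_space) expectation_fresh_draw:
  fixes X :: "nat \<Rightarrow> 'a \<Rightarrow> 'm::finite" and h :: "'m \<Rightarrow> (nat \<Rightarrow> 'm) \<Rightarrow> real"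
  assumes indep: "indep_vars (\<lambda>_. count_space UNIV) X UNIV"
    and h: "\<And>i c. h i (restrict c {..<k}) = h i c"
  shows "expectation (\<lambda>\<omega>. h (X k \<omega>) (\<lambda>j. X j \<omega>))
    = (\<Sum>i\<in>UNIV. prob {\<omega> \<in> space M. X k \<omega> = i} * expectation (\<lambda>\<omega>. h i (\<lambda>j. X j \<omega>)))"
proof -
  let ?I = "\<lambda>i \<omega>. indicator {i} (X k \<omega>) :: real"
  have X[measurable]: "X j \<in> measurable M (count_space UNIV)" for j
    using indep by (simp add: indep_vars_def)
  have int_h: "integrable M (\<lambda>\<omega>. h i (\<lambda>j. X j \<omega>))" for i
    by (rule integrable_finitely_many_draws[where X = X and h = "h i" and k = k]) (auto simp: h)
  have meas_I: "(\<lambda>\<omega>. ?I i \<omega>) \<in> borel_measurable M" for i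
    by (rule measurable_compose[OF X]) simp
  have int_I: "integrable M (?I i)" for i
    by (rule integrable_const_bound[of _ 1]) (auto simp: meas_I indicator_def)
  have ind: "indep_var borel (?I i) borel (\<lambda>\<omega>. h i (\<lambda>j. X j \<omega>))" for i
  proof -
    have "indep_var (PiM {k} (\<lambda>_. count_space UNIV)) (\<lambda>\<omega>. restrict (\<lambda>j. X j \<omega>) {k})
        (PiM {..<k} (\<lambda>_. count_space UNIV)) (\<lambda>\<omega>. restrict (\<lambda>j. X j \<omega>) {..<k})"
      by (rule indep_var_restrict[OF indep]) auto
    then have "indep_var borel ((\<lambda>c. indicator {i} (c k)) \<circ> (\<lambda>\<omega>. restrict (\<lambda>j. X j \<omega>) {k}))
       borel (h i \<circ> (\<lambda>\<omega>. restrict (\<lambda>j. X j \<omega>) {..<k}))"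
      by (rule indep_var_compose) (auto simp: count_space_PiM_finite)
    then show ?thesis by (simp add: comp_def h)
  qed
  have "expectation (\<lambda>\<omega>. h (X k \<omega>) (\<lambda>j. X j \<omega>))
      = expectation (\<lambda>\<omega>. \<Sum>i\<in>UNIV. ?I i \<omega> * h i (\<lambda>j. X j \<omega>))"
    by (simp add: indicator_def if_distrib[of "\<lambda>t. t * _"] sum.delta cong: if_cong)
  also have "\<dots> = (\<Sum>i\<in>UNIV. expectation (\<lambda>\<omega>. ?I i \<omega> * h i (\<lambda>j. X j \<omega>)))"
    by (intro Bochner_Integration.integral_sum indep_var_integrable[OF ind int_I int_h])
  also have "\<dots> = (\<Sum>i\<in>UNIV. expectation (?I i) * expectation (\<lambda>\<omega>. h i (\<lambda>j. X j \<omega>)))"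
    by (simp add: indep_var_lebesgue_integral[OF ind int_I int_h])
  also have "(\<lambda>i. expectation (?I i)) = (\<lambda>i. prob {\<omega> \<in> space M. X k \<omega> = i})"
  proof
    fix i
    have "expectation (?I i) = expectation (indicator {\<omega> \<in> space M. X k \<omega> = i})"
      by (intro Bochner_Integration.integral_cong) (auto simp: indicator_def)
    then show "expectation (?I i) = prob {\<omega> \<in> space M. X k \<omega> = i}" by simp
  qed
  finally show ?thesis .
qed

section \<open>Level sets and block norms\<close>

lemma compact_coercive_sublevel:
  fixes f :: "'a::{heine_borel,real_normed_vector} \<Rightarrow> real"
  assumes "continuous_on UNIV f" "filterlim f at_top at_infinity"
  shows "compact {x. f x \<le> c}"
proof -
  have "\<forall>\<^sub>F x in at_infinity. c < f x"
    using assms(2) by (simp add: filterlim_at_top_dense)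
  then obtain b where "\<And>x. b \<le> norm x \<Longrightarrow> c < f x"
    by (auto simp: eventually_at_infinity)
  then have "bounded {x. f x \<le> c}"
    by (auto intro!: boundedI[of _ b]) (meson linorder_not_le nle_le)
  moreover have "closed {x. f x \<le> c}"
    using assms(1) by (intro closed_Collect_le) auto
  ultimately show ?thesis by (simp add: compact_eq_bounded_closed)
qed

lemma continuous_on_block_norm:
  assumes "q > 0"
  shows "continuous_on UNIV (block_norm L P \<beta> q)"
  unfolding block_norm_def using assms
  by (intro continuous_on_powr' continuous_intros matrix_vector_mult_linear_continuous_on)
     (auto intro!: sum_nonneg)

lemma block_norm_nonneg: "block_norm L P \<beta> q x \<ge> 0"
  by (simp add: block_norm_def)

lemma block_norm_powr:
  assumes "q > 0"
  shows "block_norm L P \<beta> q x powr q = (\<Sum>i\<in>UNIV. L i powr \<beta> * norm (P i *v x) powr q)"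
  using assms by (simp add: block_norm_def powr_powr sum_nonneg)

text \<open>The minimizers form the sublevel set at height \<open>fstar\<close>, so the distances
  are the continuous image of a product of two compact sublevel sets.\<close>

lemma compact_level_distances:
  fixes f :: "real^'n \<Rightarrow> real"
  assumes cont: "continuous_on UNIV f" and "filterlim f at_top at_infinity" and "\<nu> > 1"
    and min: "\<And>x. fstar \<le> f x"
  shows "compact (level_distances f L P \<alpha> \<nu> fstar x0)"
proof -
  let ?N = "block_norm L P ((1 + \<alpha> - \<nu>) / (1 - \<nu>)) (\<nu> / (\<nu> - 1))"
  have "level_distances f L P \<alpha> \<nu> fstar x0
      = (\<lambda>(y, xs). ?N (y - xs)) ` ({y. f y \<le> f x0} \<times> {xs. f xs \<le> fstar})"
    using min by (fastforce simp: level_distances_def order.antisym)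
  moreover have "continuous_on UNIV (\<lambda>p. ?N (fst p - snd p))"
    by (rule continuous_on_compose2[OF continuous_on_block_norm])
       (use \<open>\<nu> > 1\<close> in \<open>auto intro!: continuous_intros\<close>)
  ultimately show ?thesis
    using compact_coercive_sublevel[OF assms(1,2)]
    by (auto simp: case_prod_unfold intro!: compact_continuous_image compact_Times
        elim: continuous_on_subset)
qed

section \<open>Randomized block coordinate descent\<close>

text \<open>Separating the block i from the current point x allows averaging over i while x is held
  fixed.\<close>

definition rbcd_step ::
  "real \<Rightarrow> ('m \<Rightarrow> real) \<Rightarrow> ('m \<Rightarrow> real^'n^'n) \<Rightarrow> (real^'n \<Rightarrow> real^'n) \<Rightarrow> 'm \<Rightarrow> real^'n \<Rightarrow> real^'n"
where
  "rbcd_step \<nu> L P g i x =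
     x - (norm (P i *v g x) powr (\<nu> - 2) / L i powr (\<nu> - 1)) *\<^sub>R (P i *v g x)"

lemma rbcd_Suc_step: "rbcd \<nu> L P g x0 c (Suc k) = rbcd_step \<nu> L P g (c k) (rbcd \<nu> L P g x0 c k)"
  by (simp add: rbcd_step_def Let_def)

lemma rbcd_cong:
  assumes "\<And>j. j < k \<Longrightarrow> c j = c' j"
  shows "rbcd \<nu> L P g x0 c k = rbcd \<nu> L P g x0 c' k"
  using assms by (induction k) (auto simp: rbcd_Suc_step simp del: rbcd.simps(2))

locale block_holder_convex =
  fixes f :: "real^'n \<Rightarrow> real" and g :: "real^'n \<Rightarrow> real^'n"
    and P :: "'m::finite \<Rightarrow> real^'n^'n" and L :: "'m \<Rightarrow> real" and \<gamma> \<nu> :: real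
  assumes P: "block_projections P"
    and gderiv: "\<And>x. GDERIV f x :> g x"
    and convex: "convex_on UNIV f"
    and \<gamma>: "0 < \<gamma>" "\<gamma> \<le> 1"
    and L_pos: "\<And>i. L i > 0"
    and smooth: "block_holder_smooth \<gamma> L P g"
    and \<nu>_def: "\<nu> = (1 + \<gamma>) / \<gamma>"
begin

lemma exponents: "\<nu> \<ge> 2" "1 + \<gamma> = \<nu> / (\<nu> - 1)" "(1 + \<gamma>) * (\<nu> - 1) = \<nu>" "1 - 1 / (1 + \<gamma>) = 1 / \<nu>"
  using \<gamma> by (auto simp: \<nu>_def field_simps)

lemma continuous_f: "continuous_on UNIV f"
  using gderiv by (auto simp: gderiv_def continuous_on_eq_continuous_at intro: has_derivative_continuous)

lemma gradient_minimizer: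
  assumes "\<And>y. f x \<le> f y"
  shows "g x = 0"
proof -
  have "(\<lambda>h. h \<bullet> g x) = (\<lambda>h. 0)"
    using gderiv[of x] assms by (intro differential_zero_maxmin[of x UNIV f]) (auto simp: gderiv_def)
  then show ?thesis by (metis inner_eq_zero_iff)
qed

lemma block_descent:
  "f (x + P i *v u) \<le> f x + inner (g x) (P i *v u) + L i / (1 + \<gamma>) * norm (P i *v u) powr (1 + \<gamma>)"
proof (rule holder_descent[OF gderiv \<gamma>(1)])
  fix t :: real
  have "norm (g (x + P i *v (t *\<^sub>R u)) - g x) \<le> L i * norm (P i *v (t *\<^sub>R u)) powr \<gamma>"
    using smooth unfolding block_holder_smooth_def by blast
  then show "norm (g (x + t *\<^sub>R (P i *v u)) - g x) \<le> L i * norm (t *\<^sub>R (P i *v u)) powr \<gamma>"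
    by (simp add: matrix_vector_mult_scaleR)
qed

text \<open>The step has length \<open>(norm d / L i) powr (\<nu> - 1)\<close>. At this length the
  linear term of the descent bound is -D and the Hoelder term is D / (1 + \<gamma>), and 1 - 1 / (1
  + \<gamma>) = 1 / \<nu>.\<close>

lemma rbcd_step_decrease:
  "f (rbcd_step \<nu> L P g i x) \<le> f x - norm (P i *v g x) powr \<nu> / (\<nu> * L i powr (\<nu> - 1))"
proof (cases "P i *v g x = 0")
  case False
  define d where "d = P i *v g x"
  define t where "t = norm d powr (\<nu> - 2) / L i powr (\<nu> - 1)"
  define D where "D = norm d powr \<nu> / L i powr (\<nu> - 1)"
  have d: "norm d > 0" using False by (simp add: d_def)
  have Pd: "P i *v (- t *\<^sub>R d) = - t *\<^sub>R d"
    unfolding matrix_vector_mult_scaleR by (simp add: d_def block_projections_idem[OF P])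
  have "inner (g x) d = (norm d)\<^sup>2"
    using block_projections_selfadjoint[OF P, of i "g x" d]
    by (simp add: d_def block_projections_idem[OF P] power2_norm_eq_inner)
  moreover have "t * (norm d)\<^sup>2 = D"
    using d by (simp add: t_def D_def powr_diff)
  ultimately have lin: "inner (g x) (- t *\<^sub>R d) = - D"
    by simp
  have "norm (- t *\<^sub>R d) = (norm d / L i) powr (\<nu> - 1)"
    using d L_pos[of i] by (simp add: t_def powr_diff powr_divide power2_eq_square)
  then have "norm (- t *\<^sub>R d) powr (1 + \<gamma>) = (norm d / L i) powr \<nu>"
    using exponents(3) by (simp add: powr_powr mult.commute)
  then have "L i * norm (- t *\<^sub>R d) powr (1 + \<gamma>) = D"
    using d L_pos[of i] by (simp add: D_def powr_divide powr_diff)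
  then have quad: "L i / (1 + \<gamma>) * norm (- t *\<^sub>R d) powr (1 + \<gamma>) = D / (1 + \<gamma>)"
    by (metis times_divide_eq_left)
  have "f (x + - t *\<^sub>R d) \<le> f x - D + D / (1 + \<gamma>)"
    using block_descent[of x i "- t *\<^sub>R d"] unfolding Pd lin quad by simp
  also have "\<dots> = f x - D * (1 - 1 / (1 + \<gamma>))"
    by (simp add: algebra_simps)
  finally show ?thesis
    unfolding exponents(4) by (simp add: rbcd_step_def t_def D_def d_def field_simps)
qed (use exponents in \<open>simp add: rbcd_step_def\<close>)

text \<open>This holds for every sequence of draws, not just on average, so all iterates stay in the
  level set over which R is taken.\<close>

lemma rbcd_decreasing: "f (rbcd \<nu> L P g x0 c k) \<le> f x0"
proof (induction k)
  case (Suc k)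
  have "0 \<le> norm d powr \<nu> / (\<nu> * L i powr (\<nu> - 1))" for d :: "real^'n" and i
    using exponents(1) by auto
  then show ?case
    using Suc rbcd_step_decrease[of "c k" "rbcd \<nu> L P g x0 c k"]
    unfolding rbcd_Suc_step by (smt (verit))
qed simp

text \<open>Convexity bounds the gap by an inner product, which splits over the blocks. Inserting
  the weight \<open>L i powr (\<beta> / \<nu>)\<close> and its reciprocal before applying Hoelder's
  inequality produces the two dual weighted norms.\<close>

lemma gap_le_dual_norms:
  "f x - f y \<le> (\<Sum>i\<in>UNIV. L i powr (1 + \<alpha> - \<nu>) * norm (P i *v g x) powr \<nu>) powr (1 / \<nu>)
     * block_norm L P ((1 + \<alpha> - \<nu>) / (1 - \<nu>)) (\<nu> / (\<nu> - 1)) (x - y)"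
proof -
  define \<beta> where "\<beta> = 1 + \<alpha> - \<nu>"
  define a where "a i = L i powr (\<beta> / \<nu>) * norm (P i *v g x)" for i
  define b where "b i = L i powr (- (\<beta> / \<nu>)) * norm (P i *v (x - y))" for i
  have \<nu>: "\<nu> > 1" using exponents by simp
  have "f x - f y \<le> inner (g x) (x - y)"
    using convex_on_GDERIV_ge[OF convex gderiv, of x y] by (simp add: inner_diff_right)
  also have "\<dots> = (\<Sum>i\<in>UNIV. inner (P i *v g x) (P i *v (x - y)))"
    by (rule inner_block_projections[OF P])
  also have "\<dots> \<le> (\<Sum>i\<in>UNIV. a i * b i)"
  proof (rule sum_mono)
    fix i
    have "a i * b i = norm (P i *v g x) * norm (P i *v (x - y))"
      using L_pos[of i] by (simp add: a_def b_def powr_minus)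
    then show "inner (P i *v g x) (P i *v (x - y)) \<le> a i * b i"
      using norm_cauchy_schwarz by metis
  qed
  also have "\<dots> \<le> (\<Sum>i\<in>UNIV. a i powr \<nu>) powr (1 / \<nu>)
      * (\<Sum>i\<in>UNIV. b i powr (\<nu> / (\<nu> - 1))) powr (1 / (\<nu> / (\<nu> - 1)))"
    using \<nu> by (intro Holder_sum) (auto simp: a_def b_def field_simps)
  also have "(\<lambda>i. a i powr \<nu>) = (\<lambda>i. L i powr \<beta> * norm (P i *v g x) powr \<nu>)"
    using \<nu> by (simp add: a_def powr_mult powr_powr)
  also have "(\<lambda>i. b i powr (\<nu> / (\<nu> - 1)))
      = (\<lambda>i. L i powr (\<beta> / (1 - \<nu>)) * norm (P i *v (x - y)) powr (\<nu> / (\<nu> - 1)))"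
  proof -
    \<comment> \<open>The conjugate exponent acts on the reciprocal weight; this is the origin of
      the weight exponent in \<open>level_distances\<close>.\<close>
    have "- (\<beta> / \<nu>) * (\<nu> / (\<nu> - 1)) = \<beta> / (1 - \<nu>)"
      using \<nu> by (simp add: field_simps)
    then show ?thesis by (simp add: b_def powr_mult powr_powr)
  qed
  finally show ?thesis
    by (simp add: block_norm_def \<beta>_def)
qed

lemma pow_sum_pos: "pow_sum L \<alpha> > 0"
  unfolding pow_sum_def using L_pos by (intro sum_pos) (auto simp: less_imp_neq[symmetric])

text \<open>Writing $x$ as the average of the points $x^* + P_i (x - x^*) / w_i$ with weights
  $w_i = L_i^\alpha / S_\alpha$ reduces the estimate to one block at a time.\<close>

lemma gap_le_block_norm:
  assumes min: "\<And>x. f xs \<le> f x"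
  shows "\<nu> / (\<nu> - 1) * (f x - f xs) \<le> pow_sum L \<alpha> powr (1 / (\<nu> - 1))
    * block_norm L P ((1 + \<alpha> - \<nu>) / (1 - \<nu>)) (\<nu> / (\<nu> - 1)) (x - xs) powr (\<nu> / (\<nu> - 1))"
proof -
  define q where "q = \<nu> / (\<nu> - 1)"
  define S where "S = pow_sum L \<alpha>"
  define w where "w i = L i powr \<alpha> / S" for i
  define z where "z = x - xs"
  have \<nu>: "\<nu> > 1" using exponents by simp
  \<comment> \<open>The smoothness exponent 1 + \<gamma> is the conjugate exponent of \<nu>, so the
    block estimates below add up to the norm that defines R.\<close>
  have q: "1 + \<gamma> = q" "q > 0" "q - 1 = 1 / (\<nu> - 1)"
    using exponents(2) \<nu> \<gamma> by (auto simp: q_def field_simps)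
  have S: "S > 0" by (simp add: S_def pow_sum_pos)
  have w: "w i > 0" for i using S L_pos[of i] by (simp add: w_def)
  have w1: "(\<Sum>i\<in>UNIV. w i) = 1"
    using S by (simp add: w_def S_def pow_sum_def flip: sum_divide_distrib)
  have "x = (\<Sum>i\<in>UNIV. w i *\<^sub>R (xs + P i *v ((1 / w i) *\<^sub>R z)))"
  proof -
    have "(\<Sum>i\<in>UNIV. w i *\<^sub>R (xs + P i *v ((1 / w i) *\<^sub>R z)))
        = (\<Sum>i\<in>UNIV. w i *\<^sub>R xs) + (\<Sum>i\<in>UNIV. P i *v z)"
      using w by (simp add: matrix_vector_mult_scaleR scaleR_add_right sum.distrib less_imp_neq[symmetric])
    also have "\<dots> = x"
      using w1 by (simp add: block_projections_sum[OF P] z_def flip: scaleR_left.sum)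
    finally show ?thesis by simp
  qed
  then have "f x \<le> (\<Sum>i\<in>UNIV. w i * f (xs + P i *v ((1 / w i) *\<^sub>R z)))"
    using convex_on_sum[of UNIV UNIV f w "\<lambda>i. xs + P i *v ((1 / w i) *\<^sub>R z)"] convex w w1
    by (simp add: less_imp_le)
  also have "\<dots> \<le> (\<Sum>i\<in>UNIV. w i * f xs
      + 1 / q * S powr (1 / (\<nu> - 1)) * (L i powr ((1 + \<alpha> - \<nu>) / (1 - \<nu>)) * norm (P i *v z) powr q))"
  proof (rule sum_mono)
    fix i
    have "f (xs + P i *v ((1 / w i) *\<^sub>R z)) \<le> f xs + L i / q * norm (P i *v ((1 / w i) *\<^sub>R z)) powr q"
      \<comment> \<open>The linear term vanishes because the gradient is zero at the minimizer
        \<open>xs\<close>.\<close>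
      using block_descent[of xs i "(1 / w i) *\<^sub>R z"] gradient_minimizer[OF min] q by simp
    also have "norm (P i *v ((1 / w i) *\<^sub>R z)) powr q = norm (P i *v z) powr q / w i powr q"
      using w[of i] by (simp add: matrix_vector_mult_scaleR powr_divide)
    finally have "w i * f (xs + P i *v ((1 / w i) *\<^sub>R z))
        \<le> w i * (f xs + L i / q * (norm (P i *v z) powr q / w i powr q))"
      using w[of i] by (intro mult_left_mono) auto
    \<comment> \<open>The weight enters only as \<open>w i powr (1 - q)\<close> with 1 - q = -1 /
      (\<nu> - 1). This splits into a power of S and a power of \<open>L i\<close> that completes
      the weight to the exponent used for R.\<close>
    moreover have "w i * L i / w i powr q = S powr (1 / (\<nu> - 1)) * L i powr ((1 + \<alpha> - \<nu>) / (1 - \<nu>))"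
    proof -
      have "w i / w i powr q = w i powr (- (q - 1))"
        using w[of i] by (simp add: powr_diff)
      also have "\<dots> = S powr (1 / (\<nu> - 1)) / L i powr (\<alpha> / (\<nu> - 1))"
        unfolding q w_def using S L_pos[of i] by (simp add: powr_divide powr_powr powr_minus_divide)
      finally have "w i * L i / w i powr q = S powr (1 / (\<nu> - 1)) * (L i / L i powr (\<alpha> / (\<nu> - 1)))"
        by (metis times_divide_eq_left times_divide_eq_right mult.commute)
      also have "L i / L i powr (\<alpha> / (\<nu> - 1)) = L i powr (1 - \<alpha> / (\<nu> - 1))"
        using L_pos[of i] by (simp add: powr_diff)
      also have "1 - \<alpha> / (\<nu> - 1) = (1 + \<alpha> - \<nu>) / (1 - \<nu>)"
        using \<nu> by (simp add: field_simps)
      finally show ?thesis .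
    qed
    moreover have "w i * (f xs + L i / q * (norm (P i *v z) powr q / w i powr q))
        = w i * f xs + 1 / q * (w i * L i / w i powr q) * norm (P i *v z) powr q"
      by (simp add: distrib_left)
    ultimately show "w i * f (xs + P i *v ((1 / w i) *\<^sub>R z)) \<le> w i * f xs
      + 1 / q * S powr (1 / (\<nu> - 1)) * (L i powr ((1 + \<alpha> - \<nu>) / (1 - \<nu>)) * norm (P i *v z) powr q)"
      by (simp only: mult.assoc)
  qed
  also have "\<dots> = f xs + 1 / q * S powr (1 / (\<nu> - 1)) * block_norm L P ((1 + \<alpha> - \<nu>) / (1 - \<nu>)) q z powr q"
    using w1 q by (simp add: sum.distrib block_norm_powr flip: sum_distrib_left sum_distrib_right sum_divide_distrib)
  finally have "q * (f x - f xs) \<le> S powr (1 / (\<nu> - 1)) * block_norm L P ((1 + \<alpha> - \<nu>) / (1 - \<nu>)) q z powr q"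
    using q(2) by (simp add: field_simps)
  then show ?thesis by (simp add: q_def S_def z_def)
qed

end

section \<open>Expected decrease of the gap\<close>

context block_holder_convex
begin

text \<open>Multiplying the probability, proportional to \<open>L i powr \<alpha>\<close>, by the
  decrease, proportional to \<open>L i powr (1 - \<nu>)\<close>, gives the weights in G. The duality
  estimate then bounds G from below by the \<nu>-th power of gap / R.\<close>

lemma mean_step_decrease:
  assumes gap: "f xs \<le> f x" and "R > 0"
    and R: "block_norm L P ((1 + \<alpha> - \<nu>) / (1 - \<nu>)) (\<nu> / (\<nu> - 1)) (x - xs) \<le> R"
  shows "(\<Sum>i\<in>UNIV. L i powr \<alpha> / pow_sum L \<alpha> * f (rbcd_step \<nu> L P g i x))
    \<le> f x - (f x - f xs) powr \<nu> / (\<nu> * pow_sum L \<alpha> * R powr \<nu>)"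
proof -
  define S where "S = pow_sum L \<alpha>"
  define G where "G = (\<Sum>i\<in>UNIV. L i powr (1 + \<alpha> - \<nu>) * norm (P i *v g x) powr \<nu>)"
  have \<nu>: "\<nu> > 1" using exponents by simp
  have S: "S > 0" by (simp add: S_def pow_sum_pos)
  have G: "G \<ge> 0" unfolding G_def by (intro sum_nonneg) auto
  have "f x - f xs \<le> G powr (1 / \<nu>) * R"
    using gap_le_dual_norms[of x xs \<alpha>] mult_left_mono[OF R, of "G powr (1 / \<nu>)"]
    by (simp add: G_def)
  then have "(f x - f xs) powr \<nu> \<le> (G powr (1 / \<nu>) * R) powr \<nu>"
    using gap \<nu> by (intro powr_mono2) auto
  also have "\<dots> = G * R powr \<nu>"
    using G \<nu> \<open>R > 0\<close> by (simp add: powr_mult powr_powr)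
  finally have "(f x - f xs) powr \<nu> / (\<nu> * S * R powr \<nu>) \<le> G / (\<nu> * S)"
    using \<nu> S \<open>R > 0\<close> by (simp add: field_simps)
  moreover have "(\<Sum>i\<in>UNIV. L i powr \<alpha> / S * f (rbcd_step \<nu> L P g i x))
      \<le> (\<Sum>i\<in>UNIV. L i powr \<alpha> / S * (f x - norm (P i *v g x) powr \<nu> / (\<nu> * L i powr (\<nu> - 1))))"
    using S by (intro sum_mono mult_left_mono rbcd_step_decrease) auto
  moreover have "L i powr \<alpha> / S * (f x - norm (P i *v g x) powr \<nu> / (\<nu> * L i powr (\<nu> - 1)))
      = L i powr \<alpha> * (f x / S) - L i powr (1 + \<alpha> - \<nu>) * norm (P i *v g x) powr \<nu> / (\<nu> * S)" for i
  proof -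
    have "L i powr (1 + \<alpha> - \<nu>) = L i powr \<alpha> / L i powr (\<nu> - 1)"
      by (simp add: algebra_simps flip: powr_diff)
    then show ?thesis by (simp add: right_diff_distrib mult.commute)
  qed
  then have "(\<Sum>i\<in>UNIV. L i powr \<alpha> / S * (f x - norm (P i *v g x) powr \<nu> / (\<nu> * L i powr (\<nu> - 1))))
      = S * (f x / S) - G / (\<nu> * S)"
    by (simp add: sum_subtractf G_def S_def pow_sum_def flip: sum_distrib_right sum_divide_distrib)
  ultimately show ?thesis
    using S by (simp add: S_def)
qed

text \<open>Averages the one-step decrease over the fresh draw and then over the past. Jensen's
  inequality for \<open>t powr \<nu>\<close> is carried out by hand, through the tangent at the mean
  gap.\<close>

lemma expected_gap_step:
  fixes M :: "'w measure" and blk :: "nat \<Rightarrow> 'w \<Rightarrow> 'm"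
  assumes "prob_space M"
    and indep: "prob_space.indep_vars M (\<lambda>_. count_space UNIV) blk UNIV"
    and prob: "\<And>k i. measure M {\<omega> \<in> space M. blk k \<omega> = i} = L i powr \<alpha> / pow_sum L \<alpha>"
    and min: "\<And>x. f xs \<le> f x" and "R > 0"
    and R: "\<And>x. f x \<le> f x0 \<Longrightarrow> block_norm L P ((1 + \<alpha> - \<nu>) / (1 - \<nu>)) (\<nu> / (\<nu> - 1)) (x - xs) \<le> R"
  defines "a \<equiv> \<lambda>k. (\<integral>\<omega>. f (rbcd \<nu> L P g x0 (\<lambda>j. blk j \<omega>) k) \<partial>M) - f xs"
  shows "a (Suc k) \<le> a k - a k powr \<nu> / (\<nu> * pow_sum L \<alpha> * R powr \<nu>)" and "a k \<ge> 0"
proof -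
  interpret prob_space M by fact
  define X where "X c = rbcd \<nu> L P g x0 c k" for c
  define C where "C = \<nu> * pow_sum L \<alpha> * R powr \<nu>"
  define p where "p i = L i powr \<alpha> / pow_sum L \<alpha>" for i
  have \<nu>: "\<nu> > 1" using exponents by simp
  have C: "C > 0" using \<nu> pow_sum_pos \<open>R > 0\<close> by (simp add: C_def)
  \<comment> \<open>Iterate k uses only the draws before k, so the draw \<open>blk k\<close> is
    independent of it.\<close>
  have X: "X (restrict c {..<k}) = X c" for c
    unfolding X_def by (rule rbcd_cong) simp
  have meas: "blk j \<in> measurable M (count_space UNIV)" for j
    using indep by (simp add: indep_vars_def)
  have int: "integrable M (\<lambda>\<omega>. h (X (\<lambda>j. blk j \<omega>)))" for h :: "real^'n \<Rightarrow> real"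
    by (rule integrable_finitely_many_draws[where X = blk and k = k and h = "\<lambda>c. h (X c)"])
       (auto simp: X meas)
  have int_step: "integrable M (\<lambda>\<omega>. f (rbcd_step \<nu> L P g i (X (\<lambda>j. blk j \<omega>))))" for i
    by (rule int)
  show nonneg: "a k \<ge> 0"
    using integral_mono[of M "\<lambda>_. f xs" "\<lambda>\<omega>. f (X (\<lambda>j. blk j \<omega>))"] int[of f] min
    by (simp add: a_def X_def prob_space)
  \<comment> \<open>The power of the gap is replaced by its tangent at a k, so the right-hand side
    is affine in \<open>f (X c)\<close> and can be integrated exactly.\<close>
  have step: "(\<Sum>i\<in>UNIV. p i * f (rbcd_step \<nu> L P g i (X c)))
      \<le> f (X c) - (a k powr \<nu> + \<nu> * a k powr (\<nu> - 1) * (f (X c) - f xs - a k)) / C" for c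
  proof -
    have "f (X c) \<le> f x0" unfolding X_def by (rule rbcd_decreasing)
    then have "(\<Sum>i\<in>UNIV. p i * f (rbcd_step \<nu> L P g i (X c))) \<le> f (X c) - (f (X c) - f xs) powr \<nu> / C"
      unfolding p_def C_def by (intro mean_step_decrease min \<open>R > 0\<close> R)
    moreover have "a k powr \<nu> + \<nu> * a k powr (\<nu> - 1) * (f (X c) - f xs - a k) \<le> (f (X c) - f xs) powr \<nu>"
      using powr_tangent_ge_one[of \<nu> "a k" "f (X c) - f xs"] \<nu> nonneg min[of "X c"] by simp
    ultimately show ?thesis
      using divide_right_mono[of _ _ C] C by (smt (verit))
  qed
  have "a (Suc k) + f xs = expectation (\<lambda>\<omega>. f (rbcd_step \<nu> L P g (blk k \<omega>) (X (\<lambda>j. blk j \<omega>))))"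
    by (simp add: a_def X_def rbcd_Suc_step del: rbcd.simps(2))
  also have "\<dots> = (\<Sum>i\<in>UNIV. p i * expectation (\<lambda>\<omega>. f (rbcd_step \<nu> L P g i (X (\<lambda>j. blk j \<omega>)))))"
    using expectation_fresh_draw[OF indep, of "\<lambda>i c. f (rbcd_step \<nu> L P g i (X c))" k]
    by (simp add: X prob p_def)
  also have "\<dots> = expectation (\<lambda>\<omega>. \<Sum>i\<in>UNIV. p i * f (rbcd_step \<nu> L P g i (X (\<lambda>j. blk j \<omega>))))"
    using int_step by (simp add: Bochner_Integration.integral_sum)
  also have "\<dots> \<le> expectation (\<lambda>\<omega>. f (X (\<lambda>j. blk j \<omega>))
      - (a k powr \<nu> + \<nu> * a k powr (\<nu> - 1) * (f (X (\<lambda>j. blk j \<omega>)) - f xs - a k)) / C)"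
    by (intro integral_mono int step)
  \<comment> \<open>The linear part of the tangent has mean zero, since a k is the expected gap;
    only \<open>a k powr \<nu>\<close> remains.\<close>
  also have "\<dots> = (a k + f xs) - (a k powr \<nu> + \<nu> * a k powr (\<nu> - 1) * ((a k + f xs) - f xs - a k)) / C"
    using int[of f] by (simp add: prob_space a_def X_def)
  finally show "a (Suc k) \<le> a k - a k powr \<nu> / (\<nu> * pow_sum L \<alpha> * R powr \<nu>)"
    by (simp add: C_def)
qed

end

section \<open>Attainment of the extrema and the convergence rate\<close>

theorem theorem4p3:
  fixes f :: "real^'n \<Rightarrow> real" and g :: "real^'n \<Rightarrow> real^'n"
    and P :: "'m::finite \<Rightarrow> real^'n^'n" and L :: "'m \<Rightarrow> real"
    and \<gamma> \<nu> \<alpha> fstar R :: real and x0 :: "real^'n"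
    and M :: "'w measure" and blk :: "nat \<Rightarrow> 'w \<Rightarrow> 'm"
    and bound :: "nat \<Rightarrow> real"
  assumes "block_projections P"
    and "\<And>x. GDERIV f x :> g x" and "continuous_on UNIV g"
    and "convex_on UNIV f"
    and "filterlim f at_top at_infinity"
    and "0 < \<gamma>" and "\<gamma> \<le> 1"
    and "holder_smooth \<gamma> g"
    and "\<And>i. L i > 0" and "block_holder_smooth \<gamma> L P g"
    and "\<nu> = (1 + \<gamma>) / \<gamma>"
    and "0 \<le> \<alpha>" and "\<alpha> \<le> 1"
    and "prob_space M"
    and "prob_space.indep_vars M (\<lambda>_. count_space UNIV) blk UNIV"
    and "\<And>k i. measure M {\<omega> \<in> space M. blk k \<omega> = i} = L i powr \<alpha> / pow_sum L \<alpha>"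
    and "fstar = (LEAST v. v \<in> range f)"
    and "R = (GREATEST r. r \<in> level_distances f L P \<alpha> \<nu> fstar x0)"
    and "bound = (\<lambda>k. (\<nu> * pow_sum L \<alpha> * R powr \<nu>) powr (1 / (\<nu> - 1)) * (\<nu> - 1)
           / (2 * \<nu> powr (\<nu> - 1) + (\<nu> - 1) powr \<nu> * real k) powr (1 / (\<nu> - 1)))"
  shows "fstar \<in> range f \<and> (\<forall>x. fstar \<le> f x)
    \<and> R \<in> level_distances f L P \<alpha> \<nu> fstar x0
    \<and> (\<forall>r \<in> level_distances f L P \<alpha> \<nu> fstar x0. r \<le> R)
    \<and> (\<forall>k. (\<integral>\<omega>. f (rbcd \<nu> L P g x0 (\<lambda>j. blk j \<omega>) k) \<partial>M) - fstar \<le> bound k)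
    \<and> bound \<in> O(\<lambda>k. real k powr (- 1 / (\<nu> - 1)))"
proof -
  interpret block_holder_convex f g P L \<gamma> \<nu>
    using assms by unfold_locales auto
  interpret prob_space M by fact
  let ?N = "block_norm L P ((1 + \<alpha> - \<nu>) / (1 - \<nu>)) (\<nu> / (\<nu> - 1))"
  let ?LD = "level_distances f L P \<alpha> \<nu> fstar x0"
  define S where "S = pow_sum L \<alpha>"
  define C where "C = \<nu> * S * R powr \<nu>"
  \<comment> \<open>Pulling \<open>(\<nu> - 1) powr (\<nu> - 1)\<close> out of the denominator of
    the bound leaves D + (\<nu> - 1) k, and the root of the extracted factor cancels the \<nu> - 1
    in the numerator. This is the form delivered by \<open>powr_recursion_bound\<close>.\<close>
  define D where "D = 2 * (\<nu> / (\<nu> - 1)) powr (\<nu> - 1)"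
  have \<nu>: "\<nu> \<ge> 2" "\<nu> > 1" using exponents by auto
  have S: "S > 0" by (simp add: S_def pow_sum_pos)
  have "\<exists>xs\<in>{x. f x \<le> f x0}. \<forall>x\<in>{x. f x \<le> f x0}. f xs \<le> f x"
    using compact_coercive_sublevel[OF continuous_f assms(5)]
    by (intro continuous_attains_inf continuous_on_subset[OF continuous_f]) auto
  \<comment> \<open>A minimizer over the sublevel set of x0 is global, since every point outside has
    a value above f x0.\<close>
  then obtain xs where min: "\<And>x. f xs \<le> f x"
    by (metis linorder_le_cases mem_Collect_eq order_trans)
  have fstar: "fstar = f xs"
    unfolding assms(17) by (rule Least_equality) (auto simp: min)
  have LD_I: "?N (y - xs) \<in> ?LD" if "f y \<le> f x0" for y
    using that by (auto simp: level_distances_def fstar)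
  \<comment> \<open>\<open>GREATEST\<close> denotes a maximum only once one is known to exist;
    compactness and nonemptiness (with y = x0) provide it.\<close>
  have LD_compact: "compact ?LD"
    by (rule compact_level_distances[OF continuous_f assms(5) \<nu>(2)]) (simp add: fstar min)
  have "?LD \<noteq> {}" using LD_I[of x0] by auto
  from compact_attains_sup[OF LD_compact this]
  obtain r where r: "r \<in> ?LD" "\<And>s. s \<in> ?LD \<Longrightarrow> s \<le> r" by metis
  then have "R = r"
    unfolding assms(18) by (rule Greatest_equality)
  with r have R_max: "R \<in> ?LD" "\<And>s. s \<in> ?LD \<Longrightarrow> s \<le> R" by auto
  have N_le_R: "?N (x - xs) \<le> R" if "f x \<le> f x0" for x
    using R_max(2) LD_I that by blast
  then have "R \<ge> 0"
    using block_norm_nonneg order_trans by blast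
  \<comment> \<open>The block norm estimate raised to the power \<nu> - 1, which clears the
    fractional exponents of S and R.\<close>
  have init: "(\<nu> / (\<nu> - 1) * (f x - f xs)) powr (\<nu> - 1) \<le> S * R powr \<nu>" if "f x \<le> f x0" for x
  proof -
    have "?N (x - xs) powr (\<nu> / (\<nu> - 1)) \<le> R powr (\<nu> / (\<nu> - 1))"
      using N_le_R[OF that] \<nu> by (intro powr_mono2) (auto simp: block_norm_nonneg)
    then have "\<nu> / (\<nu> - 1) * (f x - f xs) \<le> S powr (1 / (\<nu> - 1)) * R powr (\<nu> / (\<nu> - 1))"
      using gap_le_block_norm[OF min, of x \<alpha>] mult_left_mono[of _ _ "S powr (1 / (\<nu> - 1))"]
      unfolding S_def by (smt (verit) powr_ge_zero)
    then have "(\<nu> / (\<nu> - 1) * (f x - f xs)) powr (\<nu> - 1)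
        \<le> (S powr (1 / (\<nu> - 1)) * R powr (\<nu> / (\<nu> - 1))) powr (\<nu> - 1)"
      using \<nu> min[of x] by (intro powr_mono2) auto
    also have "\<dots> = S * R powr \<nu>"
      using \<nu> S by (simp add: powr_mult powr_powr)
    finally show ?thesis .
  qed
  define a where "a k = (\<integral>\<omega>. f (rbcd \<nu> L P g x0 (\<lambda>j. blk j \<omega>) k) \<partial>M) - f xs" for k
  have bound: "bound k = (C / (D + (\<nu> - 1) * real k)) powr (1 / (\<nu> - 1))" for k
  proof -
    have "2 * \<nu> powr (\<nu> - 1) + (\<nu> - 1) powr \<nu> * real k
        = (\<nu> - 1) powr (\<nu> - 1) * (D + (\<nu> - 1) * real k)"
      using \<nu> by (simp add: D_def powr_divide powr_diff field_simps)
    moreover have "((\<nu> - 1) powr (\<nu> - 1)) powr (1 / (\<nu> - 1)) = \<nu> - 1"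
      using \<nu> by (simp add: powr_powr)
    moreover have "D + (\<nu> - 1) * real k \<ge> 0" "C \<ge> 0"
      using \<nu> S by (auto simp: D_def C_def)
    ultimately show ?thesis
      using \<nu> by (simp add: assms(19) C_def[unfolded S_def] powr_mult powr_divide)
  qed
  have rate: "a k \<le> bound k" for k
  proof (cases "R = 0")
    case True
    have "f x = f xs" if "f x \<le> f x0" for x
    proof -
      have "(\<nu> / (\<nu> - 1) * (f x - f xs)) powr (\<nu> - 1) = 0"
        using init[OF that] True by (intro order.antisym) auto
      then show ?thesis using \<nu> by simp
    qed
    then have "f (rbcd \<nu> L P g x0 c k) = f xs" for c
      using rbcd_decreasing by blast
    then show ?thesis
      by (simp add: a_def bound prob_space)
  next
    case False
    then have "R > 0" using \<open>R \<ge> 0\<close> by simp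
    have step: "a (Suc k) \<le> a k - a k powr \<nu> / C" "a k \<ge> 0" for k
      unfolding a_def C_def S_def
      by (rule expected_gap_step[OF assms(14-16) min \<open>R > 0\<close> N_le_R]; assumption)+
    have a_0: "a 0 = f x0 - f xs"
      by (simp add: a_def prob_space)
    have "D * a 0 powr (\<nu> - 1) = 2 * (\<nu> / (\<nu> - 1) * (f x0 - f xs)) powr (\<nu> - 1)"
      using \<nu> min[of x0] by (simp add: D_def a_0 powr_mult powr_divide)
    also have "\<dots> \<le> 2 * (S * R powr \<nu>)"
      using init[of x0] by simp
    \<comment> \<open>The factor 2 in D is absorbed by the factor \<nu> in C; this is where \<nu>
      \<ge> 2 enters.\<close>
    also have "\<dots> \<le> C"
      using \<nu> S mult_right_mono[of 2 \<nu> "S * R powr \<nu>"] by (simp add: C_def)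
    finally show ?thesis
      unfolding bound using \<nu> S \<open>R > 0\<close> step
      by (intro powr_recursion_bound) (auto simp: C_def D_def)
  qed
  have "bound \<in> O(\<lambda>k. real k powr (- 1 / (\<nu> - 1)))"
  proof (rule bigoI, rule eventually_mono[OF eventually_gt_at_top[of 0]])
    fix k :: nat assume k: "0 < k"
    have CD: "C \<ge> 0" "D \<ge> 0" using \<nu> S by (auto simp: C_def D_def)
    \<comment> \<open>Dropping D from the denominator leaves a pure power of k, valid for k >
      0.\<close>
    have "C / (D + (\<nu> - 1) * real k) \<le> C / ((\<nu> - 1) * real k)"
      using k \<nu> CD by (intro divide_left_mono) (auto intro!: mult_pos_pos add_nonneg_pos)
    then have "bound k \<le> (C / ((\<nu> - 1) * real k)) powr (1 / (\<nu> - 1))"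
      unfolding bound using k \<nu> CD by (intro powr_mono2) auto
    also have "\<dots> = (C / (\<nu> - 1)) powr (1 / (\<nu> - 1)) * real k powr (- 1 / (\<nu> - 1))"
      using k \<nu> CD by (simp add: powr_divide powr_mult powr_minus_divide)
    finally show "norm (bound k) \<le> (C / (\<nu> - 1)) powr (1 / (\<nu> - 1)) * norm (real k powr (- 1 / (\<nu> - 1)))"
      by (simp add: bound)
  qed
  moreover have "fstar \<in> range f" "\<forall>x. fstar \<le> f x"
    using min by (auto simp: fstar)
  ultimately show ?thesis
    using R_max rate by (auto simp: fstar a_def)
qed

end
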